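(* Let $p\ge 5$ be a prime and let $n:=2^{p-1}$, so that $2n-1=2^p-1$. If $$2n-1\ \nmid\ \sum_{\substack{0\le k\le \lfloor n/2\rfloor\\ k\text{ even}}}\frac{\prod_{\lambda=0}^{\lfloor k/2\rfloor-1}\big[(4\lambda)^2-4^{-1}\big]}{k!},$$ then $2^p-1$ is composite.
   Context: The empty product $\prod_{\lambda=0}^{-1}$ equals $1$. The sum is a rational number (with $4^{-1}=\tfrac14$); an integer $M$ is said to divide a rational number $a/b$ written in lowest terms if $M\mid a$ (equivalently, $b$ is invertible modulo $M$ and $a/b\equiv 0\pmod M$). *)

theory Defs
  imports Complex_Main "HOL-Computational_Algebra.Primes"
begin

text \<open>
  \<^const>\<open>quotient_of\<close> returns numerator and (positive) denominator in lowest terms. The usual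
  divisibility on \<^typ>\<open>rat\<close> is that of a field and hence trivial, so a separate relation is needed.
\<close>

definition int_dvd_rat :: "int \<Rightarrow> rat \<Rightarrow> bool"
  where "int_dvd_rat M r \<longleftrightarrow> M dvd fst (quotient_of r)"

definition composite :: "nat \<Rightarrow> bool"
  where "composite m \<longleftrightarrow> (\<exists>a b. 1 < a \<and> 1 < b \<and> m = a * b)"

end

theory Submission
  imports Defs "HOL-Number_Theory.Number_Theory"
begin

text \<open>
  The sum is a disguised Chebyshev value, and its vanishing modulo a Mersenne prime is the necessity
  half of the Lucas-Lehmer test. Suppose that \<open>N = 2 ^ p - 1\<close> is prime, and put \<open>b = n / 4 = 2 ^ (p - 3)\<close>.

  For an even integer \<open>a = 2 * b\<close> the Taylor expansion of \<open>cos (a * arcsin x)\<close> breaks off, and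
  \[ \sum_{m \le b} \prod_{l<m} ((2 l)^2 - a^2) \frac{x^{2m}}{(2m)!} = T_b(1 - 2 x^2), \]
  where \<open>T\<^sub>b\<close> is the Chebyshev polynomial of the first kind (\<open>chebyshev_expansion\<close>, with \<open>y = 4 * x ^ 2\<close>).
  At \<open>x = 2\<close> the factors become \<open>(4 * l) ^ 2 - n ^ 2\<close>, because \<open>2 * a = n\<close>. Since
  \<open>4 * n ^ 2 = 4 ^ p\<close> is \<open>1\<close> modulo \<open>N\<close>, replacing \<open>n ^ 2\<close> by \<open>1 / 4\<close> changes each summand only by a
  multiple of \<open>N\<close>, the factorials being invertible modulo \<open>N\<close>
  (\<open>int_dvd_rat_term_diff\<close>). So the sum in the theorem is \<open>T\<^sub>b(-7)\<close> modulo \<open>N\<close>.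

  Writing \<open>\<omega> = 2 + sqrt 3\<close> and \<open>\<omega>' = 2 - sqrt 3\<close>, one has \<open>\<omega> * \<omega>' = 1\<close> and
  \<open>\<omega> ^ 2 + \<omega>' ^ 2 = 14\<close>, so \<open>2 * T\<^sub>b(-7)\<close> is \<open>\<omega> ^ (2 * b) + \<omega>' ^ (2 * b)\<close> up to sign. That
  \<open>N\<close> divides this number follows from \<open>\<omega> ^ (4 * b) = -1\<close> modulo \<open>N\<close> in the ring of integers extended by
  \<open>sqrt 3\<close>, after multiplication by \<open>\<omega>' ^ (2 * b)\<close>. The last congruence comes from
  \<open>(1 + sqrt 3) ^ 2 = 2 * \<omega>\<close>: as 3 is a quadratic non-residue modulo \<open>N\<close>, raising \<open>1 + sqrt 3\<close> to the power
  \<open>N\<close> conjugates it, whence \<open>(1 + sqrt 3) ^ (N + 1) = -2\<close>, whereas the power of 2 to be cancelled is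
  \<open>2 ^ (4 * b) = 2\<close> modulo \<open>N\<close> (\<open>mersenne_prime_dvd_chebyshev\<close>).
\<close>

section \<open>Divisibility of rational numbers\<close>

text \<open>
  Allowing any denominator prime to \<open>N\<close>, instead of the reduced one, is what makes
  divisibility visibly additive.
\<close>

lemma int_dvd_rat_iff:
  "int_dvd_rat N r \<longleftrightarrow> (\<exists>a d. coprime d N \<and> of_int d * r = of_int (N * a))"
proof -
  obtain u v where uv: "quotient_of r = (u, v)" by fastforce
  have v: "v > 0" and cop: "coprime u v" and r: "r = of_int u / of_int v"
    using uv quotient_of_denom_pos quotient_of_coprime quotient_of_div by blast+
  have "N dvd u \<longleftrightarrow> (\<exists>a d. coprime d N \<and> of_int d * r = of_int (N * a))"
  proof
    assume "N dvd u"
    then obtain a where "u = N * a" ..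
    then have "of_int v * r = of_int (N * a)" "coprime v N"
      using r v cop by (auto simp: coprime_commute)
    then show "\<exists>a d. coprime d N \<and> of_int d * r = of_int (N * a)" by blast
  next
    assume "\<exists>a d. coprime d N \<and> of_int d * r = of_int (N * a)"
    then obtain a d where d: "coprime d N" and "of_int d * r = of_int (N * a)" by blast
    then have "(of_int (d * u) :: rat) = of_int (N * a * v)"
      using r v by (simp add: field_simps)
    then have "d * u = N * a * v" by (simp only: of_int_eq_iff)
    then have "N dvd d * u" by simp
    then show "N dvd u"
      using d by (simp add: coprime_commute coprime_dvd_mult_right_iff)
  qed
  then show ?thesis by (simp add: int_dvd_rat_def uv)
qed

lemma int_dvd_rat_of_int: "N dvd t \<Longrightarrow> int_dvd_rat N (of_int t)"
  by (simp add: int_dvd_rat_def)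

lemma int_dvd_rat_add:
  assumes "int_dvd_rat N r" "int_dvd_rat N s"
  shows "int_dvd_rat N (r + s)"
proof -
  obtain a d b e where 1: "coprime d N" "of_int d * r = of_int (N * a)"
    and 2: "coprime e N" "of_int e * s = of_int (N * b)"
    using assms unfolding int_dvd_rat_iff by blast
  have "of_int (d * e) * (r + s) = of_int e * (of_int d * r) + of_int d * (of_int e * s)"
    by (simp add: algebra_simps)
  also have "\<dots> = of_int (N * (e * a + d * b))"
    unfolding 1 2 by (simp add: algebra_simps)
  finally show ?thesis
    unfolding int_dvd_rat_iff using 1 2 by (meson coprime_mult_left_iff)
qed

lemma int_dvd_rat_sum:
  assumes "\<And>x. x \<in> A \<Longrightarrow> int_dvd_rat N (f x)"
  shows "int_dvd_rat N (sum f A)"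
  using assms
  by (induction A rule: infinite_finite_induct)
     (auto intro: int_dvd_rat_add int_dvd_rat_of_int[of N 0, simplified])

section \<open>Chebyshev polynomials\<close>

fun chebyshev :: "nat \<Rightarrow> 'a::comm_ring_1 \<Rightarrow> 'a" where
  "chebyshev 0 x = 1"
| "chebyshev (Suc 0) x = x"
| "chebyshev (Suc (Suc b)) x = 2 * x * chebyshev (Suc b) x - chebyshev b x"

lemma of_int_chebyshev: "of_int (chebyshev b x) = chebyshev b (of_int x)"
  by (induction b x rule: chebyshev.induct) auto

text \<open>
  The analogue of \<open>2 * cos (b * t) = exp (\<i> * b * t) + exp (- \<i> * b * t)\<close>: both sides satisfy the same
  second-order recurrence, whose characteristic roots are \<open>u\<close> and \<open>v\<close>.
\<close>

lemma chebyshev_power_sum: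
  assumes "u * v = 1" "u + v = 2 * x"
  shows "2 * chebyshev b x = u ^ b + v ^ b"
  using assms(2)
proof (induction b x rule: chebyshev.induct)
  case (3 b x)
  have "2 * chebyshev (Suc (Suc b)) x = (u + v) * (u ^ Suc b + v ^ Suc b) - (u ^ b + v ^ b)"
    using 3 by (simp add: algebra_simps)
  also have "\<dots> = u ^ Suc (Suc b) + v ^ Suc (Suc b) + (u * v - 1) * (u ^ b + v ^ b)"
    by (simp add: algebra_simps)
  finally show ?case using assms(1) by simp
qed auto

text \<open>
  The factors are \<open>(l - x - 1) * (l + x + 1)\<close>, so the product telescopes against the one for \<open>x\<close>: up to
  sign, both run through consecutive shifts of \<open>x\<close>, and only a few factors at the ends differ.
\<close>

lemma prod_sq_diff_shift:
  fixes x :: "'a::comm_ring_1"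
  shows "(\<Prod>l<Suc (Suc m). of_nat l ^ 2 - (x + 1) ^ 2) =
    (x + 1) * (x + of_nat m + 1) * (x + of_nat m + 2) * (x * (\<Prod>l<m. of_nat (Suc l) ^ 2 - x ^ 2))"
proof (induction m)
  case 0
  then show ?case by (simp add: power2_eq_square algebra_simps)
next
  case (Suc m)
  show ?case
    unfolding prod.lessThan_Suc[of _ "Suc (Suc m)"] Suc.IH
    by (simp add: power2_eq_square algebra_simps)
qed

text \<open>
  For \<open>x = b\<close>, and divided by \<open>fact (2 * (m + 1))\<close>, this is the Chebyshev recurrence
  \<open>T\<^sub>b\<^sub>+\<^sub>1 + T\<^sub>b\<^sub>-\<^sub>1 = (2 - y) * T\<^sub>b\<close> at the argument \<open>1 - y / 2\<close>, read off at the coefficient of \<open>y ^ (m + 1)\<close>.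
\<close>

lemma prod_sq_diff_rec:
  fixes x :: "'a::comm_ring_1"
  defines "P \<equiv> \<lambda>x m. \<Prod>l<m. of_nat l ^ 2 - x ^ 2"
  shows "P (x + 1) (Suc m) + P (x - 1) (Suc m) =
         2 * P x (Suc m) - of_nat (2 * m + 1) * of_nat (2 * m + 2) * P x m"
proof (cases m)
  case 0
  then show ?thesis by (simp add: P_def power2_eq_square algebra_simps)
next
  case (Suc k)
  \<comment> \<open>All four products are multiples of \<open>K\<close>, by polynomials in \<open>x\<close> and \<open>k\<close>; this reduces the claim
    to a polynomial identity. The product at \<open>x - 1\<close> is obtained from the one at \<open>x + 1\<close> by negating
    \<open>x\<close>, under which \<open>K\<close> is odd.\<close>
  define K where "K = x * (\<Prod>l<k. of_nat (Suc l) ^ 2 - x ^ 2)"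
  have 1: "P (x + 1) (Suc m) = (x + 1) * (x + of_nat k + 1) * (x + of_nat k + 2) * K"
    unfolding Suc P_def K_def by (rule prod_sq_diff_shift)
  have "P (- x + 1) (Suc m) = (- x + 1) * (- x + of_nat k + 1) * (- x + of_nat k + 2) * - K"
    unfolding Suc P_def K_def prod_sq_diff_shift by simp
  moreover have "P (- x + 1) (Suc m) = P (x - 1) (Suc m)"
    unfolding P_def by (simp add: power2_commute)
  ultimately have 2: "P (x - 1) (Suc m) = (- x + 1) * (- x + of_nat k + 1) * (- x + of_nat k + 2) * - K"
    by simp
  have 3: "P x m = - x * K"
    unfolding Suc P_def K_def prod.lessThan_Suc_shift by (simp add: power2_eq_square)
  have 4: "P x (Suc m) = - x * K * (of_nat (Suc k) ^ 2 - x ^ 2)"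
    using 3 by (simp add: P_def Suc)
  show ?thesis
    unfolding 1 2 3 4 unfolding Suc by (simp add: power2_eq_square algebra_simps)
qed

text \<open>
  The left-hand side is the terminating Taylor expansion of \<open>cos (2 * b * arcsin x)\<close> with
  \<open>y = 4 * x ^ 2\<close>. The summation bound \<open>M\<close> may exceed \<open>b\<close> because all further terms contain the
  vanishing factor at \<open>l = b\<close>; this freedom lets the three sums of the recurrence share one range.
\<close>

lemma chebyshev_expansion:
  fixes y :: "'a::field_char_0"
  assumes "b \<le> M"
  shows "(\<Sum>m\<le>M. (\<Prod>l<m. of_nat l ^ 2 - of_nat b ^ 2) / fact (2 * m) * y ^ m) =
         chebyshev b (1 - y / 2)"
proof -
  define P where "P = (\<lambda>(x::'a) m. \<Prod>l<m. of_nat l ^ 2 - x ^ 2)"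
  define c where "c = (\<lambda>b m. P (of_nat b) m / fact (2 * m))"
  have c_0: "c b 0 = 1" for b
    by (simp add: c_def P_def)
  have c_eq_0: "c b m = 0" if "b < m" for b m
    using that by (auto simp: c_def P_def)
  have c_rec: "c (Suc (Suc b)) (Suc m) + c b (Suc m) = 2 * c (Suc b) (Suc m) - c (Suc b) m" for b m
  proof -
    define x :: 'a where "x = of_nat (Suc b)"
    have "P (x + 1) (Suc m) + P (x - 1) (Suc m) =
         2 * P x (Suc m) - of_nat (2 * m + 1) * of_nat (2 * m + 2) * P x m"
      unfolding P_def by (rule prod_sq_diff_rec)
    moreover have "x + 1 = of_nat (Suc (Suc b))" "x - 1 = of_nat b"
      by (simp_all add: x_def)
    ultimately have "P (of_nat (Suc (Suc b))) (Suc m) + P (of_nat b) (Suc m) =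
         2 * P x (Suc m) - of_nat (2 * m + 1) * of_nat (2 * m + 2) * P x m"
      by simp
    moreover have "fact (2 * Suc m) = (of_nat (2 * m + 1) * of_nat (2 * m + 2) * fact (2 * m) :: 'a)"
      by (simp add: algebra_simps)
    moreover have "(of_nat (2 * m + 1) :: 'a) \<noteq> 0" "(of_nat (2 * m + 2) :: 'a) \<noteq> 0"
      unfolding of_nat_eq_0_iff by auto
    ultimately show ?thesis
      unfolding c_def x_def[symmetric]
      by (simp add: add_divide_distrib[symmetric] diff_divide_distrib del: fact_Suc of_nat_add of_nat_mult of_nat_Suc)
  qed
  have "(\<Sum>m\<le>M. c b m * y ^ m) = chebyshev b (1 - y / 2)"
    using assms
  proof (induction b "1 - y / 2" arbitrary: M rule: chebyshev.induct)
    case 1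
    have "(\<Sum>m\<le>M. c 0 m * y ^ m) = (\<Sum>m\<le>M. if m = 0 then 1 else 0)"
      by (rule sum.cong) (auto simp: c_0 c_eq_0)
    then show ?case by simp
  next
    case 2
    then obtain M' where M: "M = Suc M'" by (cases M) auto
    have "(\<Sum>m\<le>M'. c (Suc 0) (Suc m) * y ^ Suc m) = (\<Sum>m\<le>M'. if m = 0 then - y / 2 else 0)"
      by (rule sum.cong) (auto simp: c_eq_0, simp add: c_def P_def)
    then show ?case by (simp add: M sum.atMost_Suc_shift c_0 del: sum.atMost_Suc)
  next
    case (3 b)
    then obtain M' where M: "M = Suc M'" and M': "Suc b \<le> M'" by (cases M) auto
    define F where "F = (\<lambda>b M. \<Sum>m\<le>M. c b m * y ^ m)"
    have shift: "F b M = 1 + (\<Sum>m\<le>M'. c b (Suc m) * y ^ Suc m)" for b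
      unfolding F_def M sum.atMost_Suc_shift by (simp add: c_0)
    have "F (Suc (Suc b)) M + F b M =
        2 + (\<Sum>m\<le>M'. (c (Suc (Suc b)) (Suc m) + c b (Suc m)) * y ^ Suc m)"
      unfolding shift by (simp add: sum.distrib algebra_simps)
    also have "\<dots> = 2 * F (Suc b) M - y * F (Suc b) M'"
      unfolding c_rec shift unfolding F_def
      by (simp add: sum_subtractf sum_distrib_left algebra_simps)
    finally have "F (Suc (Suc b)) M + F b M = 2 * F (Suc b) M - y * F (Suc b) M'" .
    moreover have "F (Suc b) M = chebyshev (Suc b) (1 - y / 2)"
        "F (Suc b) M' = chebyshev (Suc b) (1 - y / 2)" "F b M = chebyshev b (1 - y / 2)"
      unfolding F_def using 3 M' by simp_all
    ultimately have "F (Suc (Suc b)) M = chebyshev (Suc (Suc b)) (1 - y / 2)"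
      by (simp add: algebra_simps)
    then show ?case by (simp add: F_def)
  qed
  then show ?thesis by (simp add: c_def P_def)
qed

section \<open>The ring of integers extended by the square root of 3\<close>

definition Zsqrt3 :: "real set" where
  "Zsqrt3 = {of_int a + of_int b * sqrt 3 | a b. True}"

lemma Zsqrt3_of_int [simp, intro]: "of_int a \<in> Zsqrt3"
proof -
  have "(of_int a :: real) = of_int a + of_int 0 * sqrt 3" by simp
  then show ?thesis unfolding Zsqrt3_def by blast
qed

lemma Zsqrt3_numeral [simp, intro]: "1 \<in> Zsqrt3" "numeral k \<in> Zsqrt3" "0 \<in> Zsqrt3"
  using Zsqrt3_of_int[of 1] Zsqrt3_of_int[of "numeral k"] Zsqrt3_of_int[of 0] by auto

lemma Zsqrt3_sqrt3 [simp, intro]: "sqrt 3 \<in> Zsqrt3"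
proof -
  have "sqrt 3 = of_int 0 + of_int 1 * sqrt 3" by simp
  then show ?thesis unfolding Zsqrt3_def by blast
qed

lemma Zsqrt3_add [intro]: "x \<in> Zsqrt3 \<Longrightarrow> y \<in> Zsqrt3 \<Longrightarrow> x + y \<in> Zsqrt3"
proof -
  assume "x \<in> Zsqrt3" "y \<in> Zsqrt3"
  then obtain a b c d where "x = of_int a + of_int b * sqrt 3" "y = of_int c + of_int d * sqrt 3"
    unfolding Zsqrt3_def by blast
  then have "x + y = of_int (a + c) + of_int (b + d) * sqrt 3" by (simp add: algebra_simps)
  then show ?thesis unfolding Zsqrt3_def by blast
qed

lemma Zsqrt3_mult [intro]: "x \<in> Zsqrt3 \<Longrightarrow> y \<in> Zsqrt3 \<Longrightarrow> x * y \<in> Zsqrt3"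
proof -
  assume "x \<in> Zsqrt3" "y \<in> Zsqrt3"
  then obtain a b c d where "x = of_int a + of_int b * sqrt 3" "y = of_int c + of_int d * sqrt 3"
    unfolding Zsqrt3_def by blast
  then have "x * y = of_int (a * c + 3 * b * d) + of_int (a * d + b * c) * sqrt 3"
    by (simp add: algebra_simps)
  then show ?thesis unfolding Zsqrt3_def by blast
qed

lemma Zsqrt3_diff [intro]: "x \<in> Zsqrt3 \<Longrightarrow> y \<in> Zsqrt3 \<Longrightarrow> x - y \<in> Zsqrt3"
  using Zsqrt3_add[of x "- y"] Zsqrt3_mult[OF Zsqrt3_of_int[of "- 1"], of y] by simp

lemma Zsqrt3_power [intro]: "x \<in> Zsqrt3 \<Longrightarrow> x ^ k \<in> Zsqrt3"
  by (induction k) auto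

lemma Zsqrt3_sum [intro]: "(\<And>i. i \<in> A \<Longrightarrow> f i \<in> Zsqrt3) \<Longrightarrow> sum f A \<in> Zsqrt3"
  by (induction A rule: infinite_finite_induct) auto

definition cong_Zsqrt3 :: "nat \<Rightarrow> real \<Rightarrow> real \<Rightarrow> bool" where
  "cong_Zsqrt3 N x y \<longleftrightarrow> (\<exists>z\<in>Zsqrt3. x - y = of_nat N * z)"

lemma cong_Zsqrt3_trans [trans]:
  assumes "cong_Zsqrt3 N x y" "cong_Zsqrt3 N y z"
  shows "cong_Zsqrt3 N x z"
proof -
  obtain u v where "u \<in> Zsqrt3" "v \<in> Zsqrt3" "x - y = of_nat N * u" "y - z = of_nat N * v"
    using assms unfolding cong_Zsqrt3_def by metis
  then have "x - z = of_nat N * (u + v)" "u + v \<in> Zsqrt3"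
    by (auto simp: distrib_left)
  then show ?thesis unfolding cong_Zsqrt3_def by metis
qed

lemma cong_Zsqrt3_sym:
  assumes "cong_Zsqrt3 N x y"
  shows "cong_Zsqrt3 N y x"
proof -
  obtain u where "u \<in> Zsqrt3" "x - y = of_nat N * u"
    using assms unfolding cong_Zsqrt3_def by metis
  then have "y - x = of_nat N * (0 - u)" "0 - u \<in> Zsqrt3"
    using Zsqrt3_diff[of 0 u] by simp_all
  then show ?thesis unfolding cong_Zsqrt3_def by metis
qed

lemma cong_Zsqrt3_mult:
  assumes "c \<in> Zsqrt3" "cong_Zsqrt3 N x y"
  shows "cong_Zsqrt3 N (c * x) (c * y)"
proof -
  obtain u where "u \<in> Zsqrt3" "x - y = of_nat N * u"
    using assms unfolding cong_Zsqrt3_def by metis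
  then have "c * x - c * y = of_nat N * (c * u)" "c * u \<in> Zsqrt3"
    using assms(1) by (auto simp flip: right_diff_distrib)
  then show ?thesis unfolding cong_Zsqrt3_def by metis
qed

lemma cong_Zsqrt3_add: "cong_Zsqrt3 N x y \<Longrightarrow> cong_Zsqrt3 N (c + x) (c + y)"
  unfolding cong_Zsqrt3_def by simp

lemma cong_Zsqrt3_of_int:
  assumes "[x = y] (mod int N)"
  shows "cong_Zsqrt3 N (of_int x) (of_int y)"
proof -
  obtain c where "x - y = int N * c"
    using assms unfolding cong_iff_dvd_diff by blast
  then have "real_of_int x - real_of_int y = of_nat N * of_int c"
    by (metis of_int_diff of_int_mult of_int_of_nat_eq)
  then show ?thesis
    unfolding cong_Zsqrt3_def using Zsqrt3_of_int by metis
qed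

text \<open>
  A congruence between integers in the larger ring descends to the integers. If
  \<open>t = N * (a + b * sqrt 3)\<close>, then squaring \<open>t - N * a = N * b * sqrt 3\<close> shows that \<open>N ^ 2\<close> divides
  \<open>(t - N * a) ^ 2\<close>, and hence \<open>N\<close> divides \<open>t\<close>.
\<close>

lemma dvd_of_cong_Zsqrt3_0:
  assumes "cong_Zsqrt3 N (of_int t) 0"
  shows "int N dvd t"
proof -
  obtain a b where z: "of_int t = of_nat N * (of_int a + of_int b * sqrt 3)"
    using assms unfolding cong_Zsqrt3_def Zsqrt3_def by auto
  have "(of_int (t - int N * a) :: real) = of_int (int N * b) * sqrt 3"
    using z by (simp add: algebra_simps)
  then have "(of_int (t - int N * a) :: real) ^ 2 = (of_int (int N * b) * sqrt 3) ^ 2"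
    by (rule arg_cong)
  then have "(of_int ((t - int N * a) ^ 2) :: real) = of_int (int N ^ 2 * (3 * b ^ 2))"
    by (simp add: power_mult_distrib)
  then have "(t - int N * a) ^ 2 = int N ^ 2 * (3 * b ^ 2)"
    by (simp only: of_int_eq_iff)
  then have "int N ^ 2 dvd (t - int N * a) ^ 2" by simp
  then have "int N dvd t - int N * a" by simp
  then show ?thesis
    by (metis diff_add_cancel dvd_add dvd_triv_left)
qed

lemma freshmans_dream_Zsqrt3:
  assumes "prime N" "x \<in> Zsqrt3"
  shows "cong_Zsqrt3 N ((1 + x) ^ N) (1 + x ^ N)"
proof -
  have N: "N \<ge> 2" using assms(1) by (simp add: prime_ge_2_nat)
  define z where "z = (\<Sum>k\<in>{1..<N}. of_int (int ((N choose k) div N)) * x ^ k)"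
  have "(1 + x) ^ N = (\<Sum>k\<le>N. of_nat (N choose k) * x ^ k)"
    using binomial_ring[of x 1 N] by (simp add: add.commute)
  also have "{..N} = insert 0 (insert N {1..<N})"
    using N by auto
  also have "(\<Sum>k\<in>\<dots>. of_nat (N choose k) * x ^ k) =
      1 + x ^ N + (\<Sum>k\<in>{1..<N}. of_nat (N choose k) * x ^ k)"
    using N by simp
  also have "(\<Sum>k\<in>{1..<N}. of_nat (N choose k) * x ^ k) = of_nat N * z"
    unfolding z_def sum_distrib_left
  proof (rule sum.cong)
    fix k assume "k \<in> {1..<N}"
    then have "N dvd N choose k"
      using assms(1) by (intro dvd_choose_prime) auto
    then have "N choose k = N * ((N choose k) div N)" by simp
    then have "real (N choose k) = real N * real ((N choose k) div N)"
      by (metis of_nat_mult)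
    then show "real (N choose k) * x ^ k = real N * (of_int (int ((N choose k) div N)) * x ^ k)"
      by simp
  qed simp
  finally have "(1 + x) ^ N - (1 + x ^ N) = of_nat N * z" by simp
  moreover have "z \<in> Zsqrt3"
    using assms(2) unfolding z_def by blast
  ultimately show ?thesis
    unfolding cong_Zsqrt3_def by blast
qed

section \<open>The Lucas-Lehmer congruence for Mersenne primes\<close>

text \<open>
  The order of 2 modulo \<open>2 ^ p - 1\<close> divides \<open>p\<close>, which divides \<open>2 ^ (p - 1) - 1\<close> by Fermat's little theorem.
  The exponent is \<open>(N - 1) / 2\<close> for \<open>N = 2 ^ p - 1\<close>.
\<close>

lemma two_power_cong_mersenne:
  assumes "prime p" "odd p"
  shows "[2 ^ (2 ^ (p - 1) - 1) = 1] (mod (2 ^ p - 1 :: int))"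
proof -
  have "\<not> p dvd 2"
    using assms by (metis primes_dvd_imp_eq two_is_prime_nat even_numeral)
  then have "[2 ^ (p - 1) = 1] (mod p)"
    using assms(1) by (rule fermat_theorem[rotated])
  then have "p dvd 2 ^ (p - 1) - 1"
    by (metis cong_altdef_nat cong_sym one_le_numeral one_le_power)
  then obtain j where j: "2 ^ (p - 1) - 1 = p * j" ..
  have "[(2::int) ^ p = 1] (mod (2 ^ p - 1))"
    by (simp add: cong_iff_dvd_diff)
  then have "[((2::int) ^ p) ^ j = 1 ^ j] (mod (2 ^ p - 1))"
    by (rule cong_pow)
  then show ?thesis unfolding j power_mult by simp
qed

text \<open>
  By Euler's criterion this says that 3 is not a square modulo \<open>N = 2 ^ p - 1\<close>. Quadratic reciprocity
  gives it, since \<open>N\<close> and 3 are both \<open>3\<close> modulo 4, while \<open>N\<close> is the square \<open>1\<close> modulo 3.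
\<close>

lemma three_power_cong_mersenne:
  assumes "odd p" "p \<ge> 3" "prime (2 ^ p - 1 :: nat)"
  shows "[3 ^ (2 ^ (p - 1) - 1) = - 1] (mod (2 ^ p - 1 :: int))"
proof -
  define N :: nat where "N = 2 ^ p - 1"
  obtain i where i: "p = 2 * i + 1" "i \<ge> 1" using assms by (elim oddE) auto
  have half: "(N - 1) div 2 = 2 ^ (p - 1) - 1"
    by (simp add: N_def i)
  have intN: "int N = 2 ^ p - 1" by (simp add: N_def of_nat_diff)
  have "(2::nat) ^ 3 \<le> 2 ^ p" using assms by (intro power_increasing) auto
  then have N7: "N \<ge> 7" by (simp add: N_def)
  have "[(4::int) ^ i = 1 ^ i] (mod 3)"
    by (intro cong_pow) (simp add: cong_def)
  then have "[2 * (4::int) ^ i - 1 = 2 * 1 ^ i - 1] (mod 3)"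
    by (intro cong_diff cong_mult cong_refl)
  then have N3: "[int N = 1] (mod 3)"
    by (simp add: intN i power_mult)
  have "Legendre (int N) (int 3) = 1"
  proof -
    have "\<not> [int N = 0] (mod 3)"
      using N3 by (simp add: cong_def)
    moreover have "QuadRes 3 (int N)"
      unfolding QuadRes_def using N3 by (intro exI[of _ 1]) (simp add: cong_sym)
    ultimately show ?thesis by (simp add: Legendre_def)
  qed
  moreover have "Legendre (int 3) (int N) * Legendre (int N) (int 3)
      = (-1) ^ ((3 - 1) div 2 * ((N - 1) div 2))"
    using N7 assms(3) by (intro Quadratic_Reciprocity) (auto simp: N_def)
  moreover have "odd ((N - 1) div 2)"
    unfolding half using i by simp
  ultimately have "Legendre 3 (int N) = - 1" by simp
  moreover have "[Legendre 3 (int N) = 3 ^ ((N - 1) div 2)] (mod int N)"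
    using N7 assms(3) by (intro euler_criterion) (auto simp: N_def)
  ultimately show ?thesis
    unfolding half intN by (simp add: cong_sym)
qed

text \<open>
  The necessity half of the Lucas-Lehmer test: with \<open>s\<^sub>0 = 4\<close> and \<open>s\<^sub>i\<^sub>+\<^sub>1 = s\<^sub>i ^ 2 - 2\<close>, the Lucas-Lehmer
  residue \<open>s\<^sub>p\<^sub>-\<^sub>2\<close> is \<open>\<omega> ^ (2 * b) + \<omega>' ^ (2 * b)\<close> for \<open>b = 2 ^ (p - 3)\<close>, \<open>\<omega> = 2 + sqrt 3\<close> and
  \<open>\<omega>' = 2 - sqrt 3\<close>, and so equals twice the Chebyshev value up to sign.
\<close>

lemma mersenne_prime_dvd_chebyshev:
  assumes "prime p" "p \<ge> 5" "prime (2 ^ p - 1 :: nat)"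
  shows "(2 ^ p - 1) dvd (chebyshev (2 ^ (p - 3)) (- 7) :: int)"
proof -
  define N :: nat where "N = 2 ^ p - 1"
  define b :: nat where "b = 2 ^ (p - 3)"
  define s :: real where "s = sqrt 3"
  have s2: "s * s = 3" by (simp add: s_def)
  have s_in: "s \<in> Zsqrt3" unfolding s_def by (rule Zsqrt3_sqrt3)
  have "odd p" using assms by (simp add: prime_odd_nat)
  have intN: "int N = 2 ^ p - 1" by (simp add: N_def of_nat_diff)
  obtain j where j: "p = 3 + j" using assms(2) le_Suc_ex[of 3 p] by auto
  have "Suc N = 8 * b" "b > 0" "2 ^ (p - 1) = 4 * b"
    unfolding b_def N_def j by (simp_all add: power_add)
  then have b: "b > 0" "2 ^ (p - 1) = 4 * b" "N = Suc (2 * (4 * b - 1))"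
    by linarith+
  have two: "cong_Zsqrt3 N (2 ^ (4 * b - 1)) 1"
    using cong_Zsqrt3_of_int
      [OF two_power_cong_mersenne[OF assms(1) \<open>odd p\<close>, folded intN, unfolded b(2)]]
    by simp
  have "3 \<le> p" using assms(2) by simp
  have three: "cong_Zsqrt3 N (3 ^ (4 * b - 1)) (- 1)"
    using cong_Zsqrt3_of_int
      [OF three_power_cong_mersenne[OF \<open>odd p\<close> \<open>3 \<le> p\<close> assms(3), folded intN, unfolded b(2)]]
    by simp

  \<comment> \<open>Frobenius acts on \<open>1 + s\<close> as conjugation, so multiplying by \<open>1 + s\<close> once more yields the norm \<open>- 2\<close>.\<close>
  have "cong_Zsqrt3 N ((1 + s) ^ N) (1 + s ^ N)"
    using freshmans_dream_Zsqrt3[of N s] assms(3) s_in unfolding N_def by simp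
  moreover have "s ^ N = s * 3 ^ (4 * b - 1)"
    unfolding b by (simp add: power_mult power2_eq_square s2)
  moreover have "cong_Zsqrt3 N (1 + s * 3 ^ (4 * b - 1)) (1 + s * (- 1))"
    by (intro cong_Zsqrt3_add cong_Zsqrt3_mult s_in three)
  ultimately have "cong_Zsqrt3 N ((1 + s) ^ N) (1 + s * (- 1))"
    using cong_Zsqrt3_trans by simp
  then have "cong_Zsqrt3 N ((1 + s) * (1 + s) ^ N) ((1 + s) * (1 + s * (- 1)))"
    by (intro cong_Zsqrt3_mult) (use s_in in auto)
  moreover have "(1 + s) * (1 + s * (- 1)) = - 2"
    using s2 by (simp add: algebra_simps)
  moreover have "(1 + s) * (1 + s) ^ N = (2 * (2 + s)) ^ (4 * b)"
  proof -
    have "Suc N = 2 * (4 * b)" using b by linarith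
    then have "(1 + s) * (1 + s) ^ N = (1 + s) ^ (2 * (4 * b))"
      by (metis power_Suc)
    also have "\<dots> = ((1 + s) ^ 2) ^ (4 * b)" by (rule power_mult)
    also have "(1 + s) ^ 2 = 2 * (2 + s)"
      using s2 by (simp add: power2_eq_square algebra_simps)
    finally show ?thesis .
  qed
  \<comment> \<open>One factor 2 stays on the left-hand side: \<open>2 ^ (4 * b - 1)\<close>, with exponent \<open>(N - 1) / 2\<close>, is the
    power that is known to be 1.\<close>
  moreover have "(2 * (2 + s)) ^ (4 * b) = (2 * (2 + s) ^ (4 * b)) * 2 ^ (4 * b - 1)"
  proof -
    have "Suc (4 * b - 1) = 4 * b" using b(1) by linarith
    then have "(2::real) ^ (4 * b) = 2 * 2 ^ (4 * b - 1)"
      by (metis power_Suc)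
    then show ?thesis unfolding power_mult_distrib by simp
  qed
  ultimately have "cong_Zsqrt3 N ((2 * (2 + s) ^ (4 * b)) * 2 ^ (4 * b - 1)) (- 2)" by simp
  moreover have "cong_Zsqrt3 N ((2 * (2 + s) ^ (4 * b)) * 2 ^ (4 * b - 1)) ((2 * (2 + s) ^ (4 * b)) * 1)"
    using two s_in by (intro cong_Zsqrt3_mult) auto
  ultimately have "cong_Zsqrt3 N ((2 * (2 + s) ^ (4 * b)) * 1) (- 2)"
    using cong_Zsqrt3_sym cong_Zsqrt3_trans by blast
  then have "cong_Zsqrt3 N (2 * (2 + s) ^ (4 * b)) (- 2)" by simp
  then have "cong_Zsqrt3 N (2 + 2 * (2 + s) ^ (4 * b)) (2 + - 2)"
    by (rule cong_Zsqrt3_add)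
  \<comment> \<open>Half of the exponent is traded for the conjugate, turning the power into a trace.\<close>
  then have "cong_Zsqrt3 N ((2 - s) ^ (2 * b) * (2 + 2 * (2 + s) ^ (4 * b))) ((2 - s) ^ (2 * b) * (2 + - 2))"
    by (intro cong_Zsqrt3_mult) (use s_in in auto)
  moreover have "(2 - s) ^ (2 * b) * (2 + 2 * (2 + s) ^ (4 * b)) =
    2 * ((2 + s) ^ (2 * b) + (2 - s) ^ (2 * b))"
  proof -
    have "(2 + s) ^ (4 * b) = (2 + s) ^ (2 * b) * (2 + s) ^ (2 * b)"
      by (simp flip: power_add)
    then have "(2 - s) ^ (2 * b) * (2 + s) ^ (4 * b) =
        ((2 - s) * (2 + s)) ^ (2 * b) * (2 + s) ^ (2 * b)"
      by (simp only: power_mult_distrib mult.assoc)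
    also have "(2 - s) * (2 + s) = 1"
      using s2 by (simp add: algebra_simps)
    finally show ?thesis by (simp add: algebra_simps)
  qed
  ultimately have cong_0: "cong_Zsqrt3 N (2 * ((2 + s) ^ (2 * b) + (2 - s) ^ (2 * b))) 0"
    by simp

  \<comment> \<open>The characteristic roots for the argument \<open>- 7\<close> are the negated squares of \<open>2 + s\<close> and \<open>2 - s\<close>.\<close>
  have "2 * chebyshev b (- 7) = (- ((2 + s) ^ 2)) ^ b + (- ((2 - s) ^ 2)) ^ b"
    by (rule chebyshev_power_sum) (use s2 in \<open>simp_all add: power2_eq_square algebra_simps\<close>)
  also have "\<dots> = (- 1) ^ b * ((2 + s) ^ (2 * b) + (2 - s) ^ (2 * b))"
    by (simp add: power_minus[of "_ ^ 2"] power_mult distrib_left)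
  finally have "of_int (4 * chebyshev b (- 7)) =
      of_int ((- 1) ^ b) * (2 * ((2 + s) ^ (2 * b) + (2 - s) ^ (2 * b)))"
    by (simp add: of_int_chebyshev distrib_left)
  then have "int N dvd 4 * chebyshev b (- 7)"
    using cong_Zsqrt3_mult[OF Zsqrt3_of_int cong_0, of "(- 1) ^ b"]
    by (intro dvd_of_cong_Zsqrt3_0) simp
  moreover have "coprime (int N) 4"
  proof -
    have "odd (int N)" by (simp add: b(3))
    then have "coprime (int N) (2 ^ 2)" unfolding coprime_power_right_iff by simp
    then show ?thesis by simp
  qed
  ultimately show ?thesis
    by (simp add: coprime_dvd_mult_right_iff intN b_def)
qed

section \<open>The composite Mersenne number criterion\<close>

text \<open>
  Here \<open>1 / 4\<close> is \<open>16 * b ^ 2\<close> modulo \<open>N\<close>, because \<open>64 * b ^ 2 - 1 = (8 * b - 1) * (8 * b + 1)\<close>. Multiplying by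
  \<open>4 ^ m * fact (2 * m)\<close> clears all denominators, and this number is prime to \<open>N\<close> because
  \<open>2 * m < N\<close>.
\<close>

lemma int_dvd_rat_term_diff:
  fixes N :: nat and b m :: nat
  assumes "prime N" "Suc N = 8 * b" "m \<le> b"
  shows "int_dvd_rat (int N)
    ((\<Prod>l<m. (4 * of_nat l) ^ 2 - inverse 4) / fact (2 * m) -
     (\<Prod>l<m. of_nat l ^ 2 - of_nat b ^ 2) / fact (2 * m) * 16 ^ m)"
proof -
  have "int N = 8 * int b - 1" using assms(2) by linarith
  then have "64 * int b ^ 2 - 1 = int N * (8 * int b + 1)"
    unfolding \<open>int N = 8 * int b - 1\<close> by (simp add: power2_eq_square algebra_simps)
  then have "[64 * int l ^ 2 - 1 = 64 * int l ^ 2 - 64 * int b ^ 2] (mod int N)" for l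
    by (simp add: cong_iff_dvd_diff)
  then have "[(\<Prod>l<m. 64 * int l ^ 2 - 1) = (\<Prod>l<m. 64 * int l ^ 2 - 64 * int b ^ 2)] (mod int N)"
    by (intro cong_prod)
  then obtain a where
    a: "(\<Prod>l<m. 64 * int l ^ 2 - 1) - (\<Prod>l<m. 64 * int l ^ 2 - 64 * int b ^ 2) = int N * a"
    unfolding cong_iff_dvd_diff by blast
  have 1: "4 ^ m * (\<Prod>l<m. (4 * of_nat l) ^ 2 - inverse 4) =
      (of_int (\<Prod>l<m. 64 * int l ^ 2 - 1) :: rat)"
    by (induction m) (simp_all add: algebra_simps power2_eq_square)
  have 2: "4 ^ m * ((\<Prod>l<m. of_nat l ^ 2 - of_nat b ^ 2) * 16 ^ m) =
      (of_int (\<Prod>l<m. 64 * int l ^ 2 - 64 * int b ^ 2) :: rat)"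
    by (induction m) (simp_all add: algebra_simps power2_eq_square)
  have "of_int (4 ^ m * fact (2 * m)) * 
    ((\<Prod>l<m. (4 * of_nat l) ^ 2 - inverse 4) / fact (2 * m) -
     (\<Prod>l<m. of_nat l ^ 2 - of_nat b ^ 2) / fact (2 * m) * 16 ^ m) =
    4 ^ m * (\<Prod>l<m. (4 * of_nat l) ^ 2 - inverse 4) -
    4 ^ m * ((\<Prod>l<m. of_nat l ^ 2 - of_nat b ^ 2) * 16 ^ m :: rat)"
    by (simp add: field_simps)
  also have "\<dots> = of_int (int N * a)"
    unfolding 1 2 a[symmetric] of_int_diff ..
  moreover have "coprime (4 ^ m * fact (2 * m)) (int N)"
  proof -
    have "odd N" "2 * m < N" using assms by presburger+
    then have "\<not> N dvd fact (2 * m)" using assms(1) by (simp add: prime_dvd_fact_iff)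
    moreover have "\<not> N dvd 4 ^ m"
      using \<open>odd N\<close> assms(1) prime_dvd_power[of N 4 m] prime_dvd_power[of N 2 2]
        primes_dvd_imp_eq[of N 2] by auto
    ultimately have "\<not> N dvd 4 ^ m * fact (2 * m)"
      using assms(1) prime_dvd_mult_iff by blast
    then have "coprime (4 ^ m * fact (2 * m)) N"
      using assms(1) prime_imp_coprime coprime_commute by blast
    then have "coprime (int (4 ^ m * fact (2 * m))) (int N)"
      by (simp only: coprime_int_iff)
    then show ?thesis by simp
  qed
  ultimately show ?thesis
    unfolding int_dvd_rat_iff by metis
qed

theorem theorem7:
  fixes p n :: nat
  assumes "prime p" and "p \<ge> 5"
    and "n = 2 ^ (p - 1)"
    and "\<not> int_dvd_rat (2 * int n - 1)
           (\<Sum>k | k \<le> n div 2 \<and> even k.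
              (\<Prod>l<k div 2. (4 * of_nat l) ^ 2 - inverse 4) / fact k)"
  shows "composite (2 ^ p - 1)"
proof (rule ccontr)
  assume not_composite: "\<not> composite (2 ^ p - 1)"
  define N :: nat where "N = 2 ^ p - 1"
  define b :: nat where "b = 2 ^ (p - 3)"
  define f :: "nat \<Rightarrow> rat" where
    "f = (\<lambda>m. (\<Prod>l<m. (4 * of_nat l) ^ 2 - inverse 4) / fact (2 * m))"
  define g :: "nat \<Rightarrow> rat" where
    "g = (\<lambda>m. (\<Prod>l<m. of_nat l ^ 2 - of_nat b ^ 2) / fact (2 * m) * 16 ^ m)"
  obtain j where j: "p = 3 + j" using assms(2) le_Suc_ex[of 3 p] by auto
  have N: "Suc N = 8 * b" "b > 0" and n: "n = 4 * b"
    unfolding N_def b_def assms(3) j by (simp_all add: power_add)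
  have "2 * int n - 1 = int N" using N n by linarith
  have intN: "int N = 2 ^ p - 1" by (simp add: N_def of_nat_diff)
  have "N > 1" using N by linarith
  have "prime N"
  proof (rule ccontr)
    assume "\<not> prime N"
    then obtain a where "a dvd N" "a \<noteq> 1" "a \<noteq> N"
      using \<open>N > 1\<close> prime_nat_iff by blast
    then obtain c where "N = a * c" by blast
    then have "1 < a" "1 < c"
      using \<open>a \<noteq> 1\<close> \<open>a \<noteq> N\<close> \<open>N > 1\<close> by (cases a; cases c; force)+
    then show False
      using \<open>N = a * c\<close> not_composite unfolding composite_def N_def by blast
  qed
  \<comment> \<open>With \<open>k = 2 * m\<close>, the range \<open>k \<le> n div 2 = 2 * b\<close> ends exactly where the Chebyshev expansion
    breaks off.\<close>
  have "(\<Sum>k | k \<le> n div 2 \<and> even k.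
              (\<Prod>l<k div 2. (4 * of_nat l) ^ 2 - inverse 4) / fact k) = sum f {..b}"
    by (rule sum.reindex_bij_witness[of _ "\<lambda>m. 2 * m" "\<lambda>k. k div 2"])
       (auto simp: f_def n elim!: evenE)
  also have "\<dots> = (\<Sum>m\<le>b. f m - g m) + of_int (chebyshev b (- 7))"
  proof -
    have "(\<Sum>m\<le>b. g m) = chebyshev b (- 7)"
      using chebyshev_expansion[of b b "16 :: rat"] by (simp add: g_def)
    then show ?thesis by (simp add: sum_subtractf of_int_chebyshev)
  qed
  also have "int_dvd_rat (int N) \<dots>"
  proof (intro int_dvd_rat_add int_dvd_rat_sum int_dvd_rat_of_int)
    show "int_dvd_rat (int N) (f m - g m)" if "m \<in> {..b}" for m
      unfolding f_def g_def using \<open>prime N\<close> N that by (intro int_dvd_rat_term_diff) auto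
    show "int N dvd chebyshev b (- 7)"
      unfolding intN b_def using assms \<open>prime N\<close>
      by (intro mersenne_prime_dvd_chebyshev) (auto simp: N_def)
  qed
  finally show False
    using assms(4) \<open>2 * int n - 1 = int N\<close> by simp
qed

end
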